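(* Let $\mathbf{M}$ be an idempotent ordered monoid. Then $\mathbf{M}\cong\boxplus_{c\in C}\mathbf{M}_c$ for some chain $\mathbf{C}=\langle C,\sqsubseteq\rangle$ and some algebras $\mathbf{M}_c\in\{\mathbf{C}_2,\mathbf{C}_2^\partial,\mathbf{G}_3,\mathbf{D}_3\}$ ($c\in C$). Moreover, this nested sum is unique over the algebras $\{\mathbf{C}_2,\mathbf{C}_2^\partial,\mathbf{G}_3,\mathbf{D}_3\}$: if also $\mathbf{M}\cong\boxplus_{d\in D}\mathbf{N}_d$ for a chain $\mathbf{D}$ and algebras $\mathbf{N}_d\in\{\mathbf{C}_2,\mathbf{C}_2^\partial,\mathbf{G}_3,\mathbf{D}_3\}$, then there is an order-isomorphism $f\colon\mathbf{C}\to\mathbf{D}$ with $\mathbf{M}_c\cong\mathbf{N}_{f(c)}$ for all $c\in C$.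
   Context: An ordered monoid is a structure $\mathbf{M}=\langle M,\cdot,e,\le\rangle$ where $\langle M,\cdot,e\rangle$ is a monoid, $\le$ is a total order on $M$, and $a\le b$ implies $cad\le cbd$ for all $a,b,c,d\in M$. It is idempotent if $a\cdot a=a$ for all $a$. Isomorphisms are order-preserving monoid isomorphisms. A chain is a totally ordered set (possibly empty). The four algebras are the following idempotent ordered monoids with identity $e$: $\mathbf{C}_2$ has universe $\{\bot<e\}$; $\mathbf{C}_2^\partial$ has universe $\{e<\top\}$; $\mathbf{G}_3$ has universe $\{\bot<e<\top\}$ with $\bot\cdot\top=\bot$ and $\top\cdot\bot=\top$; $\mathbf{D}_3$ has universe $\{\bot<e<\top\}$ with $\bot\cdot\top=\top$ and $\top\cdot\bot=\bot$ (all other products are determined by idempotency and the identity). Nested sum: let $\mathbf{C}=\langle C,\sqsubseteq\rangle$ be a chain and $\{\mathbf{M}_c\}_{c\in C}$ a family of idempotent ordered monoids $\mathbf{M}_c=\langle M_c,\cdot_c,e,\le_c\rangle$, relabeled so that $M_c\cap M_d=\{e\}$ for $c\ne d$. Then $\boxplus_{c\in C}\mathbf{M}_c=\langle\bigcup_{c\in C}M_c,\cdot,e,\le\rangle$, where $\cdot$ extends every $\cdot_c$ and $a\cdot b=b\cdot a=a$ whenever $c\sqsubset d$, $a\in M_c\setminus\{e\}$, $b\in M_d$; and $\le$ is the least extension of the orders $\le_c$ such that whenever $c\sqsubset d$, $a\in M_c\setminus\{e\}$, $b\in M_d$, we have $a\le b$ if $a\le_c e$, and $b\le a$ if $e\le_c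 a$. For $C=\emptyset$ the nested sum is the trivial (one-element) ordered monoid. Nested sums are again idempotent ordered monoids. *)

theory Defs
  imports "HOL-Algebra.Group"
begin

section \<open>Idempotent ordered monoids\<close>

record 'a ord_monoid = "'a monoid" +
  ord_rel :: "'a rel"  (\<open>\<preceq>\<index>\<close>)

locale ordered_monoid = monoid M for M :: "('a, 'm) ord_monoid_scheme" (structure) +
  assumes linear_order: "linear_order_on (carrier M) \<preceq>"
    and compatible: "\<lbrakk>(a, b) \<in> \<preceq>; c \<in> carrier M; d \<in> carrier M\<rbrakk> \<Longrightarrow> (c \<otimes> a \<otimes> d, c \<otimes> b \<otimes> d) \<in> \<preceq>"

locale idem_ordered_monoid = ordered_monoid +
  assumes idem: "a \<in> carrier M \<Longrightarrow> a \<otimes> a = a"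

definition om_iso ::
    "('a, 'm) ord_monoid_scheme \<Rightarrow> ('b, 'n) ord_monoid_scheme \<Rightarrow> ('a \<Rightarrow> 'b) set" where
  "om_iso M N =
    {h \<in> iso M N. h \<one>\<^bsub>M\<^esub> = \<one>\<^bsub>N\<^esub> \<and>
      (\<forall>x\<in>carrier M. \<forall>y\<in>carrier M. (x, y) \<in> \<preceq>\<^bsub>M\<^esub> \<longleftrightarrow> (h x, h y) \<in> \<preceq>\<^bsub>N\<^esub>)}"

definition is_om_iso ::
    "('a, 'm) ord_monoid_scheme \<Rightarrow> ('b, 'n) ord_monoid_scheme \<Rightarrow> bool"  (infix \<open>\<cong>\<^sub>o\<^sub>m\<close> 50) where
  "M \<cong>\<^sub>o\<^sub>m N \<longleftrightarrow> om_iso M N \<noteq> {}"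

definition chain_iso :: "'c set \<Rightarrow> 'c rel \<Rightarrow> 'd set \<Rightarrow> 'd rel \<Rightarrow> ('c \<Rightarrow> 'd) set" where
  "chain_iso C r D s =
    {f. bij_betw f C D \<and> (\<forall>x\<in>C. \<forall>y\<in>C. (x, y) \<in> r \<longleftrightarrow> (f x, f y) \<in> s)}"


section \<open>The four algebras\<close>

datatype elt = Bot | Unit | Top

definition elt_le :: "elt rel" where
  "elt_le = {(Bot, Bot), (Bot, Unit), (Bot, Top), (Unit, Unit), (Unit, Top), (Top, Top)}"

fun lmult :: "elt \<Rightarrow> elt \<Rightarrow> elt" where
  "lmult Unit y = y"
| "lmult Bot y = Bot"
| "lmult Top y = Top"

fun rmult :: "elt \<Rightarrow> elt \<Rightarrow> elt" where
  "rmult x Unit = x"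
| "rmult x Bot = Bot"
| "rmult x Top = Top"

text \<open>On the two-element universes \<open>{Bot, Unit}\<close> and \<open>{Unit, Top}\<close>, \<^const>\<open>lmult\<close> and
  \<^const>\<open>rmult\<close> agree, both being the only idempotent operation with unit \<^const>\<open>Unit\<close>.\<close>

definition C2 :: "elt ord_monoid" where
  "C2 = \<lparr>carrier = {Bot, Unit}, mult = lmult, one = Unit, ord_rel = Restr elt_le {Bot, Unit}\<rparr>"

definition C2_dual :: "elt ord_monoid" where
  "C2_dual = \<lparr>carrier = {Unit, Top}, mult = lmult, one = Unit, ord_rel = Restr elt_le {Unit, Top}\<rparr>"

definition G3 :: "elt ord_monoid" where
  "G3 = \<lparr>carrier = {Bot, Unit, Top}, mult = lmult, one = Unit, ord_rel = elt_le\<rparr>"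

definition D3 :: "elt ord_monoid" where
  "D3 = \<lparr>carrier = {Bot, Unit, Top}, mult = rmult, one = Unit, ord_rel = elt_le\<rparr>"


section \<open>Nested sums\<close>

text \<open>The summands are relabeled so that they share exactly the identity: \<^const>\<open>None\<close> is the common
  identity, and \<open>Some (c, a)\<close> is the copy of the non-identity element \<open>a\<close> of the summand \<open>A c\<close>.\<close>

definition relabel ::
    "('c \<Rightarrow> ('b, 'm) ord_monoid_scheme) \<Rightarrow> 'c \<Rightarrow> 'b \<Rightarrow> ('c \<times> 'b) option" where
  "relabel A c a = (if a = \<one>\<^bsub>A c\<^esub> then None else Some (c, a))"

fun nested_mult ::
    "'c rel \<Rightarrow> ('c \<Rightarrow> ('b, 'm) ord_monoid_scheme) \<Rightarrow>
      ('c \<times> 'b) option \<Rightarrow> ('c \<times> 'b) option \<Rightarrow> ('c \<times> 'b) option" where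
  "nested_mult r A None y = y"
| "nested_mult r A x None = x"
| "nested_mult r A (Some (c, a)) (Some (d, b)) =
    (if c = d then relabel A c (a \<otimes>\<^bsub>A c\<^esub> b)
     else if (c, d) \<in> r then Some (c, a) else Some (d, b))"

text \<open>Rule \<open>unit\<close> only matters for the empty chain, where no summand contributes the identity.\<close>

inductive_set nested_le ::
    "'c set \<Rightarrow> 'c rel \<Rightarrow> ('c \<Rightarrow> ('b, 'm) ord_monoid_scheme) \<Rightarrow> ('c \<times> 'b) option rel"
  for C :: "'c set" and r :: "'c rel" and A :: "'c \<Rightarrow> ('b, 'm) ord_monoid_scheme" where
  unit: "(None, None) \<in> nested_le C r A"
| within: "\<lbrakk>c \<in> C; (a, b) \<in> \<preceq>\<^bsub>A c\<^esub>\<rbrakk> \<Longrightarrow> (relabel A c a, relabel A c b) \<in> nested_le C r A"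
| below: "\<lbrakk>c \<in> C; d \<in> C; (c, d) \<in> r; c \<noteq> d; a \<in> carrier (A c); a \<noteq> \<one>\<^bsub>A c\<^esub>; b \<in> carrier (A d);
    (a, \<one>\<^bsub>A c\<^esub>) \<in> \<preceq>\<^bsub>A c\<^esub>\<rbrakk> \<Longrightarrow> (relabel A c a, relabel A d b) \<in> nested_le C r A"
| above: "\<lbrakk>c \<in> C; d \<in> C; (c, d) \<in> r; c \<noteq> d; a \<in> carrier (A c); a \<noteq> \<one>\<^bsub>A c\<^esub>; b \<in> carrier (A d);
    (\<one>\<^bsub>A c\<^esub>, a) \<in> \<preceq>\<^bsub>A c\<^esub>\<rbrakk> \<Longrightarrow> (relabel A d b, relabel A c a) \<in> nested_le C r A"

definition nested_sum ::
    "'c set \<Rightarrow> 'c rel \<Rightarrow> ('c \<Rightarrow> ('b, 'm) ord_monoid_scheme) \<Rightarrow> ('c \<times> 'b) option ord_monoid" where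
  "nested_sum C r A =
    \<lparr>carrier = insert None (\<Union>c\<in>C. relabel A c ` carrier (A c)),
     mult = nested_mult r A, one = None, ord_rel = nested_le C r A\<rparr>"

end

theory Submission
  imports Defs
begin

text \<open>
  Multiplication in an idempotent ordered monoid always returns one of its two arguments: this is
  plain for arguments on the same side of \<open>\<one>\<close>, where the product is the argument further away from
  \<open>\<one>\<close>, and it follows in general by comparing the product itself with \<open>\<one>\<close>
  (\<open>mult_conservative\<close>).
  Hence \<open>a \<otimes> b \<otimes> a = a\<close> (``\<open>a\<close> absorbs \<open>b\<close>'') is a total preorder, the \<open>\<J>\<close>-preorder of the band
  (\<open>J_le_trans\<close>, \<open>J_le_total\<close>).
  Two elements on the same side of \<open>\<one>\<close> are compared by the order exactly as they are compared by
  absorption, up to reversal above \<open>\<one>\<close>. So an equivalence class of mutual absorption contains at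
  most one element below and at most one element above \<open>\<one>\<close>. A class other than \<open>{\<one>}\<close> forms,
  together with \<open>\<one>\<close>, one of the four algebras, and two elements of different classes commute, the
  smaller one in the preorder winning. The chain of the classes other than \<open>{\<one>}\<close>, with those
  algebras as summands, is the decomposition sought: an element different from \<open>\<one>\<close> is determined by
  its class and its sign (below or above \<open>\<one>\<close>), and both multiplication (\<open>coord_mult\<close>) and order
  (\<open>coord_le_iff\<close>) can be read off from these two coordinates.

  For uniqueness, the order \<open>(c, d) \<in> r\<close> on the indices of a nested sum of the four algebras says
  precisely that an element of the summand \<open>c\<close> other than the identity absorbs one of the summand
  \<open>d\<close> (\<open>nested_absorb_iff\<close>), and isomorphisms preserve signs. Hence the
  coordinates of an element other than \<open>\<one>\<close> under any isomorphism to such a sum are its class and its sign, the index chain is the chain of these classes, and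
  each summand is the algebra of the corresponding class (\<open>summand_eq_class_algebra\<close>).
\<close>

section \<open>The four algebras and signed comparison\<close>

abbreviation (input) basic_algebras :: "elt ord_monoid set" where
  "basic_algebras \<equiv> {C2, C2_dual, G3, D3}"

lemma basic_carrier:
  "carrier C2 = {Bot, Unit}" "carrier C2_dual = {Unit, Top}"
  "carrier G3 = {Bot, Unit, Top}" "carrier D3 = {Bot, Unit, Top}"
  by (simp_all add: C2_def C2_dual_def G3_def D3_def)

lemma basic_mult:
  "mult C2 = lmult" "mult C2_dual = lmult" "mult G3 = lmult" "mult D3 = rmult"
  by (simp_all add: C2_def C2_dual_def G3_def D3_def)

lemma basic_one: "B \<in> basic_algebras \<Longrightarrow> \<one>\<^bsub>B\<^esub> = Unit"
  by (auto simp: C2_def C2_dual_def G3_def D3_def)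

lemma basic_Unit: "B \<in> basic_algebras \<Longrightarrow> Unit \<in> carrier B"
  by (auto simp: basic_carrier)

lemma basic_le: assumes "B \<in> basic_algebras" shows "\<preceq>\<^bsub>B\<^esub> = Restr elt_le (carrier B)"
proof -
  have "{Bot, Unit, Top} = UNIV" using elt.exhaust by blast
  from this assms show ?thesis
    by (elim insertE emptyE) (simp_all add: C2_def C2_dual_def G3_def D3_def)
qed

lemma basic_nontrivial: "B \<in> basic_algebras \<Longrightarrow> Bot \<in> carrier B \<or> Top \<in> carrier B"
  by (auto simp: basic_carrier)

text \<open>Non-identity elements multiply as in a left zero or as in a right zero band. In particular their
  product is never the identity and \<open>a\<close> absorbs \<open>b\<close>; inside a nested sum, this makes all
  non-identity elements of one summand equivalent.\<close>

lemma basic_mult_cases: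
  assumes "B \<in> basic_algebras" "a \<noteq> Unit" "b \<noteq> Unit"
  shows "a \<otimes>\<^bsub>B\<^esub> b = a \<and> b \<otimes>\<^bsub>B\<^esub> a = b \<or> a \<otimes>\<^bsub>B\<^esub> b = b \<and> b \<otimes>\<^bsub>B\<^esub> a = a"
proof -
  have "lmult a b = a" "lmult b a = b" "rmult a b = b" "rmult b a = a"
    using assms(2,3) by (cases a; cases b; simp)+
  then show ?thesis using assms(1) by (auto simp: basic_mult)
qed

lemma basic_algebra_eqI:
  assumes A: "A \<in> basic_algebras" and B: "B \<in> basic_algebras"
    and car: "\<And>s. s \<noteq> Unit \<Longrightarrow> s \<in> carrier A \<longleftrightarrow> s \<in> carrier B"
    and mul: "Bot \<in> carrier A \<Longrightarrow> Top \<in> carrier A \<Longrightarrow> Bot \<otimes>\<^bsub>A\<^esub> Top = Bot \<otimes>\<^bsub>B\<^esub> Top"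
  shows "A = B"
proof -
  have "Bot \<in> carrier A \<longleftrightarrow> Bot \<in> carrier B" "Top \<in> carrier A \<longleftrightarrow> Top \<in> carrier B"
    using car by blast+
  with A B mul show ?thesis
    by (elim insertE emptyE) (simp_all add: basic_carrier basic_mult)
qed

lemma om_iso_refl: "M \<cong>\<^sub>o\<^sub>m M"
proof -
  have "(\<lambda>x. x) \<in> om_iso M M"
    by (auto simp: om_iso_def iso_def hom_def bij_betw_def inj_on_def)
  then show ?thesis unfolding is_om_iso_def by blast
qed

text \<open>The common shape of the order in a monoid and in a nested sum: it is given by the signs, except
  between two elements of the same sign, where the absorption preorder decides. \<open>P\<close> stands for ``the
  first absorbs the second'' and \<open>Q\<close> for the converse.\<close>

definition signed_le :: "bool \<Rightarrow> bool \<Rightarrow> elt \<Rightarrow> elt \<Rightarrow> bool" where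
  "signed_le P Q a b \<longleftrightarrow>
    (if a = Bot \<and> b = Bot then P else if a = Top \<and> b = Top then Q else (a, b) \<in> elt_le)"


section \<open>Absorption in an idempotent ordered monoid\<close>

context idem_ordered_monoid
begin

lemma le_carrier: "(a, b) \<in> \<preceq> \<Longrightarrow> a \<in> carrier M \<and> b \<in> carrier M"
  using linear_order by (auto simp: order_on_defs)

lemma le_refl: "a \<in> carrier M \<Longrightarrow> (a, a) \<in> \<preceq>"
  using linear_order by (auto simp: order_on_defs refl_on_def)

lemma le_antisym: "(a, b) \<in> \<preceq> \<Longrightarrow> (b, a) \<in> \<preceq> \<Longrightarrow> a = b"
  using linear_order by (auto simp: order_on_defs dest: antisymD)

lemma le_trans: "(a, b) \<in> \<preceq> \<Longrightarrow> (b, c) \<in> \<preceq> \<Longrightarrow> (a, c) \<in> \<preceq>"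
  using linear_order by (auto simp: order_on_defs dest: transD)

lemma le_total: "a \<in> carrier M \<Longrightarrow> b \<in> carrier M \<Longrightarrow> (a, b) \<in> \<preceq> \<or> (b, a) \<in> \<preceq>"
  using linear_order le_refl by (cases "a = b") (auto simp: order_on_defs total_on_def)

lemma mult_mono_left: "(a, b) \<in> \<preceq> \<Longrightarrow> c \<in> carrier M \<Longrightarrow> (c \<otimes> a, c \<otimes> b) \<in> \<preceq>"
  using compatible[of a b c \<one>] le_carrier[of a b] by simp

lemma mult_mono_right: "(a, b) \<in> \<preceq> \<Longrightarrow> c \<in> carrier M \<Longrightarrow> (a \<otimes> c, b \<otimes> c) \<in> \<preceq>"
  using compatible[of a b \<one> c] le_carrier[of a b] by simp

lemma mult_below_one:
  assumes "(a, b) \<in> \<preceq>" and "(b, \<one>) \<in> \<preceq>"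
  shows "a \<otimes> b = a" and "b \<otimes> a = a"
proof -
  have ab: "a \<in> carrier M" "b \<in> carrier M"
    using le_carrier[OF assms(1)] by auto
  show "a \<otimes> b = a"
    using mult_mono_left[OF assms(1) ab(1)] mult_mono_left[OF assms(2) ab(1)] ab idem
    by (auto intro: le_antisym)
  show "b \<otimes> a = a"
    using mult_mono_right[OF assms(1) ab(1)] mult_mono_right[OF assms(2) ab(1)] ab idem
    by (auto intro: le_antisym)
qed

lemma mult_above_one:
  assumes "(\<one>, a) \<in> \<preceq>" and "(a, b) \<in> \<preceq>"
  shows "a \<otimes> b = b" and "b \<otimes> a = b"
proof -
  have ab: "a \<in> carrier M" "b \<in> carrier M"
    using le_carrier[OF assms(2)] by auto
  show "a \<otimes> b = b"
    using mult_mono_right[OF assms(2) ab(2)] mult_mono_right[OF assms(1) ab(2)] ab idem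
    by (auto intro: le_antisym)
  show "b \<otimes> a = b"
    using mult_mono_left[OF assms(2) ab(2)] mult_mono_left[OF assms(1) ab(2)] ab idem
    by (auto intro: le_antisym)
qed

text \<open>If \<open>a\<close> and \<open>b\<close> lie on different sides of \<open>\<one>\<close>, then \<open>a \<otimes> b\<close> lies between them. It is fixed
  under multiplication by \<open>a\<close> from the left and by \<open>b\<close> from the right, and it is on the same side
  as one of the two, so the same-side case identifies it with that one.\<close>

lemma mult_conservative:
  assumes a: "a \<in> carrier M" and b: "b \<in> carrier M"
  shows "a \<otimes> b = a \<or> a \<otimes> b = b"
proof -
  have ab: "a \<otimes> b \<in> carrier M" using a b by simp
  have aab: "a \<otimes> (a \<otimes> b) = a \<otimes> b"
    using a b idem by (metis m_assoc)
  have abb: "(a \<otimes> b) \<otimes> b = a \<otimes> b"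
    using a b idem by (metis m_assoc)
  consider (neg) "(a, \<one>) \<in> \<preceq>" "(b, \<one>) \<in> \<preceq>" | (pos) "(\<one>, a) \<in> \<preceq>" "(\<one>, b) \<in> \<preceq>"
    | (np) "(a, \<one>) \<in> \<preceq>" "(\<one>, b) \<in> \<preceq>" | (pn) "(\<one>, a) \<in> \<preceq>" "(b, \<one>) \<in> \<preceq>"
    using le_total[OF a one_closed] le_total[OF b one_closed] by blast
  then show ?thesis
  proof cases
    case neg
    then show ?thesis using le_total[OF a b] mult_below_one by blast
  next
    case pos
    then show ?thesis using le_total[OF a b] mult_above_one by blast
  next
    case np
    have "(a, a \<otimes> b) \<in> \<preceq>" "(a \<otimes> b, b) \<in> \<preceq>"
      using mult_mono_left[OF np(2) a] mult_mono_right[OF np(1) b] a b by auto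
    then show ?thesis
      using le_total[OF ab one_closed] mult_below_one(1)[of a "a \<otimes> b"]
        mult_above_one(1)[of "a \<otimes> b" b] aab abb by auto
  next
    case pn
    have "(b, a \<otimes> b) \<in> \<preceq>" "(a \<otimes> b, a) \<in> \<preceq>"
      using mult_mono_left[OF pn(2) a] mult_mono_right[OF pn(1) b] a b by auto
    then show ?thesis
      using le_total[OF ab one_closed] mult_below_one(2)[of b "a \<otimes> b"]
        mult_above_one(2)[of "a \<otimes> b" a] aab abb by auto
  qed
qed

text \<open>Green's \<open>\<J>\<close>-preorder, which for bands takes this form. The smaller elements are
  the ones that win in products, in accordance with the orientation of chains in nested sums.\<close>

definition J_le :: "'a \<Rightarrow> 'a \<Rightarrow> bool" where
  "J_le a b \<longleftrightarrow> a \<otimes> b \<otimes> a = a"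

definition J_equiv :: "'a \<Rightarrow> 'a \<Rightarrow> bool" where
  "J_equiv a b \<longleftrightarrow> J_le a b \<and> J_le b a"

lemma J_le_iff:
  assumes "a \<in> carrier M" and "b \<in> carrier M"
  shows "J_le a b \<longleftrightarrow> a \<otimes> b = a \<or> b \<otimes> a = a"
  using assms mult_conservative[OF assms] idem unfolding J_le_def by (metis m_assoc)

lemma J_le_refl: "a \<in> carrier M \<Longrightarrow> J_le a a"
  by (simp add: J_le_iff idem)

lemma J_le_total: "a \<in> carrier M \<Longrightarrow> b \<in> carrier M \<Longrightarrow> J_le a b \<or> J_le b a"
  using mult_conservative[of a b] by (auto simp: J_le_iff)

text \<open>By conservativity, absorption holds on the left or on the right. If \<open>a\<close> absorbs \<open>b\<close> and \<open>b\<close>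
  absorbs \<open>c\<close> on the same side, associativity suffices. In the mixed cases it yields
  \<open>a \<otimes> c \<otimes> b = a\<close> or its mirror image, where the product of \<open>a\<close> and \<open>c\<close> is \<open>a\<close> unless \<open>a = b\<close>.\<close>

lemma J_le_trans:
  assumes a: "a \<in> carrier M" and b: "b \<in> carrier M" and c: "c \<in> carrier M"
    and le: "J_le a b" "J_le b c"
  shows "J_le a c"
proof -
  consider "a \<otimes> b = a" "b \<otimes> c = b" | "b \<otimes> a = a" "c \<otimes> b = b"
    | (lr) "a \<otimes> b = a" "c \<otimes> b = b" | (rl) "b \<otimes> a = a" "b \<otimes> c = b"
    using le a b c by (auto simp: J_le_iff)
  then show ?thesis
  proof cases
    case 1
    then have "a \<otimes> c = a" using a b c by (metis m_assoc)
    then show ?thesis using a c by (simp add: J_le_iff)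
  next
    case 2
    then have "c \<otimes> a = a" using a b c by (metis m_assoc)
    then show ?thesis using a c by (simp add: J_le_iff)
  next
    case lr
    then have "a \<otimes> c \<otimes> b = a" using a b c by (simp add: m_assoc)
    then have "a \<otimes> c = a \<or> a = b" using mult_conservative[OF a c] lr by auto
    then show ?thesis using a c lr by (auto simp: J_le_iff)
  next
    case rl
    then have "b \<otimes> (c \<otimes> a) = a" using a b c by (simp flip: m_assoc)
    then have "c \<otimes> a = a \<or> a = b" using mult_conservative[OF c a] rl by auto
    then show ?thesis using a c rl by (auto simp: J_le_iff)
  qed
qed

lemma J_equiv_refl: "a \<in> carrier M \<Longrightarrow> J_equiv a a"
  by (simp add: J_equiv_def J_le_refl)

lemma J_equiv_sym: "J_equiv a b \<Longrightarrow> J_equiv b a"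
  by (simp add: J_equiv_def)

lemma J_equiv_trans:
  "J_equiv a b \<Longrightarrow> J_equiv b c \<Longrightarrow>
    a \<in> carrier M \<Longrightarrow> b \<in> carrier M \<Longrightarrow> c \<in> carrier M \<Longrightarrow> J_equiv a c"
  unfolding J_equiv_def using J_le_trans by blast

lemma J_equiv_one: "a \<in> carrier M \<Longrightarrow> J_equiv a \<one> \<longleftrightarrow> a = \<one>"
  by (auto simp: J_equiv_def J_le_def)

text \<open>Elements of different classes commute, as they do across the summands of a nested sum.\<close>

lemma mult_strict:
  assumes a: "a \<in> carrier M" and b: "b \<in> carrier M" and "\<not> J_le b a"
  shows "a \<otimes> b = a" and "b \<otimes> a = a"
  using assms(3) mult_conservative[OF a b] mult_conservative[OF b a]
  by (auto simp: J_le_iff[OF b a])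


subsection \<open>Signs\<close>

definition sign :: "'a \<Rightarrow> elt" where
  "sign a = (if a = \<one> then Unit else if (a, \<one>) \<in> \<preceq> then Bot else Top)"

lemma sign_Unit: "sign a = Unit \<longleftrightarrow> a = \<one>"
  by (simp add: sign_def)

lemma sign_Bot: "sign a = Bot \<longleftrightarrow> a \<noteq> \<one> \<and> (a, \<one>) \<in> \<preceq>"
  by (simp add: sign_def)

lemma sign_Top: "a \<in> carrier M \<Longrightarrow> sign a = Top \<longleftrightarrow> a \<noteq> \<one> \<and> (\<one>, a) \<in> \<preceq>"
  using le_total[OF _ one_closed] le_antisym by (auto simp: sign_def)

lemma le_iff_J_le_below:
  assumes "sign a = Bot" and "sign b = Bot"
  shows "(a, b) \<in> \<preceq> \<longleftrightarrow> J_le a b"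
proof -
  have neg: "(a, \<one>) \<in> \<preceq>" "(b, \<one>) \<in> \<preceq>" using assms by (auto simp: sign_Bot)
  then have c: "a \<in> carrier M" "b \<in> carrier M" using le_carrier by blast+
  show ?thesis
    using le_total[OF c] mult_below_one[of a b] mult_below_one[of b a] neg c
    by (auto simp: J_le_iff)
qed

lemma le_iff_J_le_above:
  assumes "a \<in> carrier M" "b \<in> carrier M" and "sign a = Top" and "sign b = Top"
  shows "(a, b) \<in> \<preceq> \<longleftrightarrow> J_le b a"
proof -
  have pos: "(\<one>, a) \<in> \<preceq>" "(\<one>, b) \<in> \<preceq>" using assms by (auto simp: sign_Top)
  show ?thesis
    using le_total[OF assms(1,2)] mult_above_one[of a b] mult_above_one[of b a] pos assms(1,2)
    by (auto simp: J_le_iff)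
qed

text \<open>Between elements of one sign, mutual absorption means being comparable in both directions, so
  a class has at most two elements besides \<open>\<one>\<close>.\<close>

lemma J_equiv_sign_eq:
  assumes "a \<in> carrier M" "b \<in> carrier M" "J_equiv a b" "sign a = sign b"
  shows "a = b"
proof (cases "sign a")
  case Bot
  then show ?thesis
    using assms le_iff_J_le_below[of a b] le_iff_J_le_below[of b a]
    by (auto simp: J_equiv_def intro: le_antisym)
next
  case Unit
  then show ?thesis using assms by (metis sign_Unit)
next
  case Top
  then show ?thesis
    using assms le_iff_J_le_above[of a b] le_iff_J_le_above[of b a]
    by (auto simp: J_equiv_def intro: le_antisym)
qed

lemma le_iff_sign:
  assumes "a \<in> carrier M" "b \<in> carrier M"
  shows "(a, b) \<in> \<preceq> \<longleftrightarrow> signed_le (J_le a b) (J_le b a) (sign a) (sign b)"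
proof (cases "sign a"; cases "sign b")
  assume "sign a = Bot" "sign b = Bot"
  then show ?thesis by (simp add: signed_le_def le_iff_J_le_below)
next
  assume "sign a = Top" "sign b = Top"
  then show ?thesis using assms by (simp add: signed_le_def le_iff_J_le_above)
qed (use assms in \<open>auto simp: signed_le_def elt_le_def sign_Bot sign_Top sign_Unit
      intro: le_trans le_refl dest: le_antisym\<close>)

text \<open>Distinct equivalent elements do not commute, so a class with two elements yields \<^const>\<open>G3\<close>
  or \<^const>\<open>D3\<close>.\<close>

lemma J_equiv_mult:
  assumes a: "a \<in> carrier M" and b: "b \<in> carrier M" and "J_equiv a b" "a \<noteq> b"
  shows "a \<otimes> b = a \<and> b \<otimes> a = b \<or> a \<otimes> b = b \<and> b \<otimes> a = a"
proof -
  have "a \<otimes> b \<otimes> a = a" "b \<otimes> a \<otimes> b = b"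
    using assms by (auto simp: J_equiv_def J_le_def)
  then show ?thesis
    using mult_conservative[OF a b] mult_conservative[OF b a] idem[OF a] idem[OF b] assms(4)
    by auto
qed


subsection \<open>The algebra carried by an absorption class\<close>

definition class_algebra :: "'a \<Rightarrow> elt ord_monoid" where
  "class_algebra a =
    (if \<exists>x\<in>carrier M. \<exists>y\<in>carrier M. J_equiv x a \<and> J_equiv y a \<and> sign x = Bot \<and> sign y = Top \<and>
        x \<otimes> y = x then G3
     else if \<exists>x\<in>carrier M. \<exists>y\<in>carrier M. J_equiv x a \<and> J_equiv y a \<and> sign x = Bot \<and> sign y = Top
        then D3
     else if sign a = Bot then C2 else C2_dual)"

lemma class_algebra_basic: "class_algebra a \<in> basic_algebras"
  by (simp add: class_algebra_def)

text \<open>The witnesses in the definition of \<open>class_algebra\<close> are unique, since the sign separates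
  equivalent elements.\<close>

lemma class_algebra_cases [consumes 2]:
  assumes a: "a \<in> carrier M" and "a \<noteq> \<one>"
  obtains (single) "\<And>z. z \<in> carrier M \<Longrightarrow> J_equiv z a \<Longrightarrow> z = a"
      "class_algebra a = (if sign a = Bot then C2 else C2_dual)"
  | (pair) x y where "x \<in> carrier M" "y \<in> carrier M" "J_equiv x a" "J_equiv y a"
      "sign x = Bot" "sign y = Top" "class_algebra a = (if x \<otimes> y = x then G3 else D3)"
      "\<And>z. z \<in> carrier M \<Longrightarrow> J_equiv z a \<Longrightarrow> z = x \<or> z = y"
proof (cases "\<exists>x\<in>carrier M. \<exists>y\<in>carrier M. J_equiv x a \<and> J_equiv y a \<and> sign x = Bot \<and> sign y = Top")
  case True
  then obtain x y where xy: "x \<in> carrier M" "y \<in> carrier M" "J_equiv x a" "J_equiv y a"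
      "sign x = Bot" "sign y = Top"
    by blast
  have eq: "u = v" if "u \<in> carrier M" "v \<in> carrier M" "J_equiv u a" "J_equiv v a" "sign u = sign v"
    for u v
    using that a J_equiv_sign_eq J_equiv_trans J_equiv_sym by metis
  have sgn: "sign z = Bot \<or> sign z = Top" if "z \<in> carrier M" "J_equiv z a" for z
    using that a assms(2) J_equiv_one J_equiv_sym by (metis elt.exhaust sign_Unit)
  have z: "z = x \<or> z = y" if "z \<in> carrier M" "J_equiv z a" for z
    using sgn[OF that] eq[of z x] eq[of z y] that xy by auto
  have "class_algebra a = (if x \<otimes> y = x then G3 else D3)"
  proof (cases "x \<otimes> y = x")
    case True
    then show ?thesis using xy by (auto simp: class_algebra_def)
  next
    case False
    have "\<not> (\<exists>u\<in>carrier M. \<exists>v\<in>carrier M. J_equiv u a \<and> J_equiv v a \<and> sign u = Bot \<and> sign v = Top \<and>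
        u \<otimes> v = u)"
      using eq[of _ x] eq[of _ y] xy False by (metis)
    moreover have "\<exists>x\<in>carrier M. \<exists>y\<in>carrier M. J_equiv x a \<and> J_equiv y a \<and> sign x = Bot \<and> sign y = Top"
      using xy by blast
    ultimately show ?thesis using False unfolding class_algebra_def by presburger
  qed
  then show ?thesis using pair xy z by blast
next
  case False
  have "z = a" if z: "z \<in> carrier M" "J_equiv z a" for z
  proof (rule J_equiv_sign_eq[OF z(1) a z(2)])
    have "sign z \<noteq> Unit" "sign a \<noteq> Unit"
      using z a assms(2) J_equiv_one J_equiv_sym by (metis sign_Unit)+
    then show "sign z = sign a"
      using False z a J_equiv_refl[OF a] by (cases "sign z"; cases "sign a") auto
  qed
  moreover have "class_algebra a = (if sign a = Bot then C2 else C2_dual)"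
    using False unfolding class_algebra_def by auto
  ultimately show ?thesis using single by blast
qed

lemma carrier_class_algebra:
  assumes "a \<in> carrier M" "a \<noteq> \<one>" "s \<noteq> Unit"
  shows "s \<in> carrier (class_algebra a) \<longleftrightarrow> (\<exists>x\<in>carrier M. J_equiv x a \<and> sign x = s)"
  using assms(1,2)
proof (cases rule: class_algebra_cases)
  case single
  then have "(\<exists>x\<in>carrier M. J_equiv x a \<and> sign x = s) \<longleftrightarrow> sign a = s"
    using assms J_equiv_refl by blast
  then show ?thesis
    using single(2) assms by (cases s; cases "sign a") (auto simp: basic_carrier sign_Unit)
next
  case (pair x y)
  then have "(\<exists>x\<in>carrier M. J_equiv x a \<and> sign x = s) \<longleftrightarrow> s \<in> {Bot, Top}"
    by blast
  then show ?thesis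
    using pair assms by (cases s) (auto simp: basic_carrier)
qed

lemma sign_mult:
  assumes "a \<in> carrier M" "a \<noteq> \<one>" and x: "x \<in> carrier M" "J_equiv x a"
    and y: "y \<in> carrier M" "J_equiv y a"
  shows "sign (x \<otimes> y) = sign x \<otimes>\<^bsub>class_algebra a\<^esub> sign y"
  using assms(1,2)
proof (cases rule: class_algebra_cases)
  case single
  have "x = a" "y = a" using single(1) x y by blast+
  moreover have "sign a \<noteq> Unit" "a \<otimes> a = a"
    using assms(1,2) by (auto simp: sign_Unit idem)
  ultimately show ?thesis
    using single(2) by (cases "sign a") (simp_all add: basic_mult)
next
  case (pair u v)
  have "J_equiv u v"
    by (rule J_equiv_trans[OF pair(3) J_equiv_sym[OF pair(4)] pair(1) assms(1) pair(2)])
  moreover have ne: "u \<noteq> v" using pair(5,6) by auto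
  ultimately have uv: "u \<otimes> v = u \<and> v \<otimes> u = v \<or> u \<otimes> v = v \<and> v \<otimes> u = u"
    using J_equiv_mult[OF pair(1,2)] by blast
  have "u \<otimes> u = u" "v \<otimes> v = v" using pair(1,2) idem by auto
  with uv ne show ?thesis
    using pair(8)[OF x] pair(8)[OF y]
    by (elim disjE conjE) (simp_all add: pair(5,6,7) basic_mult)
qed

text \<open>One of the four algebras is pinned down by the signs that occur in it and, if both do, by one
  product. This identifies the algebra of a class from its abstract properties; it serves to show
  that equivalent elements have the same algebra, and to recognize the summands of an arbitrary
  decomposition.\<close>

lemma class_algebra_eqI:
  assumes a: "a \<in> carrier M" "a \<noteq> \<one>" and B: "B \<in> basic_algebras"
    and car: "\<And>s. s \<noteq> Unit \<Longrightarrow> s \<in> carrier B \<longleftrightarrow> (\<exists>x\<in>carrier M. J_equiv x a \<and> sign x = s)"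
    and mul: "\<And>x y. x \<in> carrier M \<Longrightarrow> y \<in> carrier M \<Longrightarrow> J_equiv x a \<Longrightarrow> J_equiv y a \<Longrightarrow>
      sign (x \<otimes> y) = sign x \<otimes>\<^bsub>B\<^esub> sign y"
  shows "B = class_algebra a"
proof (rule basic_algebra_eqI[OF B class_algebra_basic])
  show "s \<in> carrier B \<longleftrightarrow> s \<in> carrier (class_algebra a)" if "s \<noteq> Unit" for s
    using car[OF that] carrier_class_algebra[OF a that] by simp
next
  assume "Bot \<in> carrier B" "Top \<in> carrier B"
  then obtain x y where "x \<in> carrier M" "J_equiv x a" "sign x = Bot"
      "y \<in> carrier M" "J_equiv y a" "sign y = Top"
    using car[of Bot] car[of Top] by auto
  then show "Bot \<otimes>\<^bsub>B\<^esub> Top = Bot \<otimes>\<^bsub>class_algebra a\<^esub> Top"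
    using mul[of x y] sign_mult[OF a, of x y] by simp
qed

lemma class_algebra_cong:
  assumes "a \<in> carrier M" "a \<noteq> \<one>" "b \<in> carrier M" "J_equiv a b"
  shows "class_algebra a = class_algebra b"
proof (rule sym, rule class_algebra_eqI[OF assms(1,2) class_algebra_basic])
  have eq: "J_equiv x a \<longleftrightarrow> J_equiv x b" if "x \<in> carrier M" for x
    using assms that J_equiv_trans J_equiv_sym by blast
  have b: "b \<noteq> \<one>" using assms J_equiv_one by blast
  show "s \<in> carrier (class_algebra b) \<longleftrightarrow> (\<exists>x\<in>carrier M. J_equiv x a \<and> sign x = s)"
    if "s \<noteq> Unit" for s
    using carrier_class_algebra[OF assms(3) b that] eq by blast
  show "sign (x \<otimes> y) = sign x \<otimes>\<^bsub>class_algebra b\<^esub> sign y"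
    if "x \<in> carrier M" "y \<in> carrier M" "J_equiv x a" "J_equiv y a" for x y
    using sign_mult[OF assms(3) b] that eq by blast
qed

end

section \<open>Nested sums of the four algebras\<close>

lemma carrier_nested_sum:
  assumes "\<forall>c\<in>C. A c \<in> basic_algebras"
  shows "carrier (nested_sum C r A) =
    insert None {Some (c, a) |c a. c \<in> C \<and> a \<in> carrier (A c) \<and> a \<noteq> Unit}"
  using assms basic_one by (auto simp: nested_sum_def relabel_def split: if_splits)

fun nested_sign :: "('c \<times> elt) option \<Rightarrow> elt" where
  "nested_sign None = Unit"
| "nested_sign (Some (c, a)) = a"

lemma nested_le_signed:
  assumes lin: "linear_order_on C r" and bas: "\<forall>c\<in>C. A c \<in> basic_algebras"
    and le: "(Some (c, a), Some (d, b)) \<in> nested_le C r A"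
  shows "signed_le ((c, d) \<in> r) ((d, c) \<in> r) a b"
proof -
  have refl: "(c, c) \<in> r" if "c \<in> C" for c
    using lin that by (auto simp: order_on_defs refl_on_def)
  have elt: "s \<noteq> Unit \<Longrightarrow> s \<noteq> Bot \<Longrightarrow> s = Top" "s \<noteq> Unit \<Longrightarrow> s \<noteq> Top \<Longrightarrow> s = Bot" for s
    by (cases s; simp)+
  from le show ?thesis
    by cases (use bas in \<open>auto simp: relabel_def basic_one basic_le signed_le_def elt_le_def refl
        split: if_splits intro: elt\<close>)
qed

text \<open>The map that forgets the index is monotone: the rules across summands only relate an
  element of sign \<^const>\<open>Bot\<close> to something above it, or one of sign \<^const>\<open>Top\<close> to something below.\<close>

lemma nested_le_sign:
  assumes bas: "\<forall>c\<in>C. A c \<in> basic_algebras" and le: "(p, q) \<in> nested_le C r A"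
  shows "(nested_sign p, nested_sign q) \<in> elt_le"
proof -
  have extremal: "(Bot, s) \<in> elt_le" "(s, Top) \<in> elt_le" for s
    by (cases s; simp add: elt_le_def)+
  have relab: "nested_sign (relabel A c s) = s" if "c \<in> C" for c s
    using bas that by (simp add: relabel_def basic_one)
  have ord: "(s, t) \<in> elt_le" if "c \<in> C" "(s, t) \<in> \<preceq>\<^bsub>A c\<^esub>" for c s t
    using bas that by (simp add: basic_le)
  have neg: "s = Bot" if "(s, Unit) \<in> elt_le" "s \<noteq> Unit" for s
    using that by (auto simp: elt_le_def)
  have pos: "s = Top" if "(Unit, s) \<in> elt_le" "s \<noteq> Unit" for s
    using that by (auto simp: elt_le_def)
  from le show ?thesis
  proof cases
    case unit
    then show ?thesis by (simp add: elt_le_def)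
  next
    case (within c a b)
    then show ?thesis by (simp add: relab ord)
  next
    case (below c d a b)
    then have "a = Bot" using ord[of c a Unit] neg bas by (simp add: basic_one)
    then show ?thesis using below by (simp add: relab extremal)
  next
    case (above c d a b)
    then have "a = Top" using ord[of c Unit a] pos bas by (simp add: basic_one)
    then show ?thesis using above by (simp add: relab extremal)
  qed
qed

text \<open>The order of a nested sum obeys the same formula as the order of a monoid in the lemma
  \<open>le_iff_sign\<close>, with the order of the indices in the place of absorption.\<close>

lemma nested_le_Some_iff:
  assumes lin: "linear_order_on C r" and bas: "\<forall>c\<in>C. A c \<in> basic_algebras"
    and c: "c \<in> C" "a \<in> carrier (A c)" "a \<noteq> Unit" and d: "d \<in> C" "b \<in> carrier (A d)" "b \<noteq> Unit"
  shows "(Some (c, a), Some (d, b)) \<in> nested_le C r A \<longleftrightarrow>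
    signed_le ((c, d) \<in> r) ((d, c) \<in> r) a b" (is "?L \<longleftrightarrow> ?R")
proof
  assume ?R
  have relab: "relabel A c a = Some (c, a)" "relabel A d b = Some (d, b)"
    using bas c d by (auto simp: relabel_def basic_one)
  show ?L
  proof (cases "c = d")
    case True
    have "(a, b) \<in> elt_le"
      using \<open>?R\<close> c d by (auto simp: signed_le_def elt_le_def split: if_splits)
    then show ?thesis
      using nested_le.within[of c C a b A r] relab bas c d True by (auto simp: basic_le)
  next
    case False
    have tot: "(c, d) \<in> r \<or> (d, c) \<in> r"
      using lin c d False by (auto simp: order_on_defs total_on_def)
    consider "a = Bot" "(c, d) \<in> r" | "b = Top" "(d, c) \<in> r"
      using \<open>?R\<close> tot c d by (cases a; cases b) (auto simp: signed_le_def elt_le_def)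
    then show ?thesis
    proof cases
      case 1
      then show ?thesis
        using nested_le.below[of c C d r a A b] relab bas c d False
        by (auto simp: basic_le basic_one basic_Unit elt_le_def)
    next
      case 2
      then show ?thesis
        using nested_le.above[of d C c r b A a] relab bas c d False
        by (auto simp: basic_le basic_one basic_Unit elt_le_def)
    qed
  qed
qed (rule nested_le_signed[OF lin bas])

lemma nested_le_None_iff:
  assumes bas: "\<forall>c\<in>C. A c \<in> basic_algebras" and c: "c \<in> C" "a \<in> carrier (A c)" "a \<noteq> Unit"
  shows "(Some (c, a), None) \<in> nested_le C r A \<longleftrightarrow> a = Bot"
    and "(None, Some (c, a)) \<in> nested_le C r A \<longleftrightarrow> a = Top"
proof -
  have relab: "relabel A c a = Some (c, a)" "relabel A c Unit = None"
    using bas c by (auto simp: relabel_def basic_one)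
  have B: "A c \<in> basic_algebras" using bas c by blast
  show "(Some (c, a), None) \<in> nested_le C r A \<longleftrightarrow> a = Bot"
    using nested_le_sign[OF bas, of "Some (c, a)" None r] nested_le.within[OF c(1), of a Unit A r]
      relab c basic_le[OF B] basic_Unit[OF B]
    by (cases a) (auto simp: elt_le_def)
  show "(None, Some (c, a)) \<in> nested_le C r A \<longleftrightarrow> a = Top"
    using nested_le_sign[OF bas, of None "Some (c, a)" r] nested_le.within[OF c(1), of Unit a A r]
      relab c basic_le[OF B] basic_Unit[OF B]
    by (cases a) (auto simp: elt_le_def)
qed

lemma nested_mult_same:
  assumes "A c \<in> basic_algebras" "a \<noteq> Unit" "b \<noteq> Unit"
  shows "nested_mult r A (Some (c, a)) (Some (c, b)) = Some (c, a \<otimes>\<^bsub>A c\<^esub> b)"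
  using assms basic_mult_cases[OF assms] basic_one[OF assms(1)] by (auto simp: relabel_def)

text \<open>This recovers the index order from multiplication alone, which is what makes the chain an
  isomorphism invariant.\<close>

lemma nested_absorb_iff:
  assumes lin: "linear_order_on C r" and bas: "\<forall>c\<in>C. A c \<in> basic_algebras"
    and c: "c \<in> C" "a \<noteq> Unit" and d: "d \<in> C" "b \<noteq> Unit"
  shows "nested_mult r A (nested_mult r A (Some (c, a)) (Some (d, b))) (Some (c, a)) = Some (c, a)
    \<longleftrightarrow> (c, d) \<in> r"
proof (cases "c = d")
  case True
  have B: "A c \<in> basic_algebras" using bas c by blast
  have "(c, c) \<in> r" using lin c by (auto simp: order_on_defs refl_on_def)
  moreover have "a \<otimes>\<^bsub>A c\<^esub> b \<noteq> Unit" "a \<otimes>\<^bsub>A c\<^esub> b \<otimes>\<^bsub>A c\<^esub> a = a"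
    using basic_mult_cases[OF B c(2) d(2)] basic_mult_cases[OF B c(2) c(2)] c d by metis+
  ultimately show ?thesis
    using c d B True by (simp add: nested_mult_same del: nested_mult.simps(3))
next
  case False
  have B: "A c \<in> basic_algebras" using bas c by blast
  have "(c, d) \<in> r \<longleftrightarrow> (d, c) \<notin> r"
    using lin c d False by (auto simp: order_on_defs total_on_def dest: antisymD)
  moreover have "a \<otimes>\<^bsub>A c\<^esub> a = a"
    using basic_mult_cases[OF B c(2) c(2)] by blast
  ultimately show ?thesis
    using False nested_mult_same[of A c a a r, OF B c(2) c(2)] by auto
qed


section \<open>Existence\<close>

context idem_ordered_monoid
begin

text \<open>Classes are indexed by representatives, so that the chain consists of elements of \<open>M\<close>. The class
  of \<open>\<one>\<close> is \<open>{\<one>}\<close> and contributes no index.\<close>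

definition rep :: "'a \<Rightarrow> 'a" where
  "rep a = (SOME x. x \<in> carrier M \<and> J_equiv x a)"

definition rep_order :: "'a rel" where
  "rep_order = {(c, d). c \<in> rep ` (carrier M - {\<one>}) \<and> d \<in> rep ` (carrier M - {\<one>}) \<and> J_le c d}"

definition coord :: "'a \<Rightarrow> ('a \<times> elt) option" where
  "coord a = (if a = \<one> then None else Some (rep a, sign a))"

lemma rep: "a \<in> carrier M \<Longrightarrow> rep a \<in> carrier M \<and> J_equiv (rep a) a"
  unfolding rep_def by (rule someI[of _ a]) (simp add: J_equiv_refl)

lemma J_le_rep:
  assumes "a \<in> carrier M" "b \<in> carrier M"
  shows "J_le (rep a) (rep b) \<longleftrightarrow> J_le a b"
  using rep[OF assms(1)] rep[OF assms(2)] assms J_le_trans unfolding J_equiv_def by metis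

lemma rep_eq_iff:
  assumes "a \<in> carrier M" "b \<in> carrier M"
  shows "rep a = rep b \<longleftrightarrow> J_equiv a b"
proof
  assume "rep a = rep b"
  then show "J_equiv a b"
    using rep[OF assms(1)] rep[OF assms(2)] assms J_equiv_trans J_equiv_sym by metis
next
  assume ab: "J_equiv a b"
  have "x \<in> carrier M \<and> J_equiv x a \<longleftrightarrow> x \<in> carrier M \<and> J_equiv x b" for x
    using ab assms J_equiv_trans J_equiv_sym by metis
  then show "rep a = rep b" unfolding rep_def by presburger
qed

lemma rep_one: "a \<in> carrier M \<Longrightarrow> rep a = \<one> \<longleftrightarrow> a = \<one>"
  using rep[of a] J_equiv_one J_equiv_sym by metis

lemma rep_order_iff:
  assumes "a \<in> carrier M" "a \<noteq> \<one>" "b \<in> carrier M" "b \<noteq> \<one>"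
  shows "(rep a, rep b) \<in> rep_order \<longleftrightarrow> J_le a b"
  using assms by (auto simp: rep_order_def J_le_rep)

lemma linear_order_rep: "linear_order_on (rep ` (carrier M - {\<one>})) rep_order"
proof -
  let ?C = "rep ` (carrier M - {\<one>})"
  have "rep_order \<subseteq> ?C \<times> ?C"
    by (auto simp: rep_order_def)
  moreover have "refl_on ?C rep_order"
    by (auto simp: refl_on_def rep_order_iff J_le_refl)
  moreover have "trans rep_order"
  proof (rule transI)
    fix c d e assume "(c, d) \<in> rep_order" "(d, e) \<in> rep_order"
    then show "(c, e) \<in> rep_order"
      using rep J_le_trans unfolding rep_order_def by blast
  qed
  moreover have "antisym rep_order"
  proof (rule antisymI)
    fix c d assume "(c, d) \<in> rep_order" "(d, c) \<in> rep_order"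
    then show "c = d"
      by (auto simp: rep_order_def J_le_rep rep_eq_iff J_equiv_def)
  qed
  moreover have "total_on ?C rep_order"
    using J_le_total by (auto simp: total_on_def rep_order_iff)
  ultimately show ?thesis
    by (simp add: order_on_defs)
qed

lemma class_algebra_rep:
  "a \<in> carrier M \<Longrightarrow> a \<noteq> \<one> \<Longrightarrow> class_algebra (rep a) = class_algebra a"
  using rep[of a] rep_one class_algebra_cong J_equiv_sym by metis

lemma sign_in_class_algebra:
  "a \<in> carrier M \<Longrightarrow> a \<noteq> \<one> \<Longrightarrow> sign a \<in> carrier (class_algebra a)"
  using carrier_class_algebra[of a "sign a"] J_equiv_refl by (auto simp: sign_Unit)

lemma coord_mult:
  assumes x: "x \<in> carrier M" and y: "y \<in> carrier M"
  shows "coord (x \<otimes> y) = nested_mult rep_order class_algebra (coord x) (coord y)"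
proof (cases "x = \<one> \<or> y = \<one>")
  case True
  then show ?thesis using x y by (cases "coord x") (auto simp: coord_def)
next
  case False
  then have ne: "x \<noteq> \<one>" "y \<noteq> \<one>" by auto
  then have xy: "x \<otimes> y \<noteq> \<one>" using mult_conservative[OF x y] by auto
  show ?thesis
  proof (cases "J_equiv x y")
    case True
    then have yx: "rep y = rep x" using x y J_equiv_sym by (simp add: rep_eq_iff)
    have "rep (x \<otimes> y) = rep x" using mult_conservative[OF x y] yx by auto
    moreover have "sign (x \<otimes> y) = sign x \<otimes>\<^bsub>class_algebra (rep x)\<^esub> sign y"
      using sign_mult[OF x ne(1) x J_equiv_refl[OF x] y J_equiv_sym[OF True]]
        class_algebra_rep[OF x ne(1)] by simp
    ultimately show ?thesis
      using ne xy yx 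
          nested_mult_same[where A = class_algebra, OF class_algebra_basic,
            of "sign x" "sign y" rep_order "rep x"]
      by (simp add: coord_def sign_Unit del: nested_mult.simps(3))
  next
    case False
    then have neq: "rep x \<noteq> rep y" using x y by (simp add: rep_eq_iff)
    show ?thesis
    proof (cases "J_le x y")
      case True
      then have "x \<otimes> y = x" using False mult_strict(1)[OF x y] by (simp add: J_equiv_def)
      then show ?thesis
        using True neq ne x y by (simp add: coord_def rep_order_iff)
    next
      case False
      then have "x \<otimes> y = y" using mult_strict(2)[OF y x] by simp
      then show ?thesis
        using False neq ne x y by (simp add: coord_def rep_order_iff)
    qed
  qed
qed

lemma coord_bij:
  "bij_betw coord (carrier M)
    (carrier (nested_sum (rep ` (carrier M - {\<one>})) rep_order class_algebra))"
proof -
  have "inj_on coord (carrier M)"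
  proof (rule inj_onI)
    fix x y assume "x \<in> carrier M" "y \<in> carrier M" "coord x = coord y"
    then show "x = y"
      using J_equiv_sign_eq[of x y] by (simp add: coord_def rep_eq_iff split: if_splits)
  qed
  moreover have "coord ` carrier M =
      insert None {Some (c, s) |c s. c \<in> rep ` (carrier M - {\<one>}) \<and>
        s \<in> carrier (class_algebra c) \<and> s \<noteq> Unit}" (is "_ = ?R")
  proof
    show "coord ` carrier M \<subseteq> ?R"
    proof
      fix p assume "p \<in> coord ` carrier M"
      then obtain x where x: "x \<in> carrier M" "p = coord x" by blast
      show "p \<in> ?R"
      proof (cases "x = \<one>")
        case False
        then have "sign x \<in> carrier (class_algebra (rep x))" "sign x \<noteq> Unit"
          using x by (simp_all add: class_algebra_rep sign_in_class_algebra sign_Unit)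
        then show ?thesis using x False by (simp add: coord_def)
      qed (simp add: x coord_def)
    qed
  next
    have "Some (rep a, s) \<in> coord ` carrier M"
      if a: "a \<in> carrier M" "a \<noteq> \<one>" "s \<in> carrier (class_algebra (rep a))" "s \<noteq> Unit" for a s
    proof -
      obtain x where x: "x \<in> carrier M" "J_equiv x a" "sign x = s"
        using a(3) carrier_class_algebra[OF a(1,2,4)] class_algebra_rep[OF a(1,2)] by auto
      then have "x \<noteq> \<one>" "rep x = rep a" using a by (auto simp: sign_Unit rep_eq_iff)
      then have "coord x = Some (rep a, s)" using x by (simp add: coord_def)
      then show ?thesis using x(1) by (metis image_eqI)
    qed
    moreover have "None \<in> coord ` carrier M"
      by (rule image_eqI[of _ _ \<one>]) (simp_all add: coord_def)
    ultimately show "?R \<subseteq> coord ` carrier M" by auto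
  qed
  ultimately show ?thesis
    using carrier_nested_sum[of "rep ` (carrier M - {\<one>})" class_algebra rep_order]
      class_algebra_basic by (simp add: bij_betw_def)
qed

lemma coord_le_iff:
  assumes x: "x \<in> carrier M" and y: "y \<in> carrier M"
  shows "(x, y) \<in> \<preceq> \<longleftrightarrow>
    (coord x, coord y) \<in> nested_le (rep ` (carrier M - {\<one>})) rep_order class_algebra"
    (is "_ \<longleftrightarrow> _ \<in> nested_le ?C _ _")
proof -
  have bas: "\<forall>c\<in>?C. class_algebra c \<in> basic_algebras"
    using class_algebra_basic by blast
  have coord_mem: "rep z \<in> ?C" "sign z \<in> carrier (class_algebra (rep z))" "sign z \<noteq> Unit"
    if "z \<in> carrier M" "z \<noteq> \<one>" for z
    using that by (auto simp: class_algebra_rep sign_in_class_algebra sign_Unit)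
  show ?thesis
  proof (cases "x = \<one>"; cases "y = \<one>")
    assume "x = \<one>" "y = \<one>"
    then show ?thesis by (simp add: coord_def le_refl nested_le.unit)
  next
    assume 1: "x = \<one>" "y \<noteq> \<one>"
    then show ?thesis
      using nested_le_None_iff(2)[OF bas coord_mem[OF y]] y
      by (simp add: coord_def sign_Top)
  next
    assume "x \<noteq> \<one>" "y = \<one>"
    then show ?thesis
      using nested_le_None_iff(1)[OF bas coord_mem[OF x]]
      by (simp add: coord_def sign_Bot)
  next
    assume ne: "x \<noteq> \<one>" "y \<noteq> \<one>"
    then show ?thesis
      using nested_le_Some_iff[OF linear_order_rep bas coord_mem[OF x ne(1)] coord_mem[OF y ne(2)]]
        x y by (simp add: coord_def le_iff_sign rep_order_iff)
  qed
qed

theorem nested_sum_decomposition: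
  "M \<cong>\<^sub>o\<^sub>m nested_sum (rep ` (carrier M - {\<one>})) rep_order class_algebra"
proof -
  let ?N = "nested_sum (rep ` (carrier M - {\<one>})) rep_order class_algebra"
  have "coord \<in> carrier M \<rightarrow> carrier ?N"
    using coord_bij by (auto simp: bij_betw_def)
  moreover have "mult ?N = nested_mult rep_order class_algebra" "one ?N = None"
      "ord_rel ?N = nested_le (rep ` (carrier M - {\<one>})) rep_order class_algebra"
    by (simp_all add: nested_sum_def)
  ultimately have "coord \<in> om_iso M ?N"
    using coord_bij coord_mult coord_le_iff
    by (auto simp: om_iso_def iso_def hom_def coord_def)
  then show ?thesis unfolding is_om_iso_def by blast
qed

end


section \<open>Uniqueness\<close>

text \<open>An arbitrary isomorphism \<open>h\<close> onto a nested sum of the four algebras is shown to consist of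
  an index map, which is a quotient map for mutual absorption, and the sign.\<close>

locale nested_decomposition = idem_ordered_monoid M
  for M :: "('a, 'm) ord_monoid_scheme" (structure) +
  fixes C :: "'c set" and r :: "'c rel" and A :: "'c \<Rightarrow> elt ord_monoid"
    and h :: "'a \<Rightarrow> ('c \<times> elt) option"
  assumes chain: "linear_order_on C r"
    and basic: "\<forall>c\<in>C. A c \<in> basic_algebras"
    and iso: "h \<in> om_iso M (nested_sum C r A)"
begin

definition index :: "'a \<Rightarrow> 'c" where
  "index x = fst (the (h x))"

lemma h_bij: "bij_betw h (carrier M)
    (insert None {Some (c, a) |c a. c \<in> C \<and> a \<in> carrier (A c) \<and> a \<noteq> Unit})"
  using iso carrier_nested_sum[OF basic, of r] by (simp add: om_iso_def iso_def)

lemma h_one: "h \<one> = None"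
  using iso by (simp add: om_iso_def nested_sum_def)

lemma h_mult: "x \<in> carrier M \<Longrightarrow> y \<in> carrier M \<Longrightarrow> h (x \<otimes> y) = nested_mult r A (h x) (h y)"
  using iso by (simp add: om_iso_def iso_def hom_def nested_sum_def)

lemma h_le: "x \<in> carrier M \<Longrightarrow> y \<in> carrier M \<Longrightarrow>
    (x, y) \<in> \<preceq> \<longleftrightarrow> (h x, h y) \<in> nested_le C r A"
  using iso by (simp add: om_iso_def nested_sum_def)

lemma h_inj: "x \<in> carrier M \<Longrightarrow> y \<in> carrier M \<Longrightarrow> h x = h y \<longleftrightarrow> x = y"
  using h_bij by (auto simp: bij_betw_def dest: inj_onD)

text \<open>The second coordinate is the sign because \<open>h\<close> preserves comparison with the identity.\<close>

lemma h_Some: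
  assumes x: "x \<in> carrier M" "x \<noteq> \<one>"
  shows "h x = Some (index x, sign x)" and "index x \<in> C" and "sign x \<in> carrier (A (index x))"
proof -
  have "h x \<noteq> None" using h_inj[OF x(1) one_closed] h_one x by simp
  moreover have "h x \<in> insert None {Some (c, a) |c a. c \<in> C \<and> a \<in> carrier (A c) \<and> a \<noteq> Unit}"
    using h_bij x unfolding bij_betw_def by blast
  ultimately obtain c a where ca: "h x = Some (c, a)" "c \<in> C" "a \<in> carrier (A c)" "a \<noteq> Unit"
    by auto
  have "a = Bot \<longleftrightarrow> (x, \<one>) \<in> \<preceq>"
    using h_le[OF x(1) one_closed] h_one ca nested_le_None_iff(1)[OF basic ca(2,3,4), of r] by simp
  then have "a = sign x"
    using x ca(4) by (cases a) (auto simp: sign_def)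
  then show "h x = Some (index x, sign x)" "index x \<in> C" "sign x \<in> carrier (A (index x))"
    using ca by (auto simp: index_def)
qed

lemma h_onto:
  assumes "c \<in> C" "a \<in> carrier (A c)" "a \<noteq> Unit"
  shows "\<exists>x\<in>carrier M. x \<noteq> \<one> \<and> index x = c \<and> sign x = a"
proof -
  have "Some (c, a) \<in> h ` carrier M"
    using h_bij assms unfolding bij_betw_def by blast
  then obtain x where x: "x \<in> carrier M" "h x = Some (c, a)" by auto
  then have "x \<noteq> \<one>" using h_one by auto
  then show ?thesis using x h_Some[OF x(1)] by auto
qed

lemma index_onto: "c \<in> C \<Longrightarrow> \<exists>x\<in>carrier M. x \<noteq> \<one> \<and> index x = c"
  using basic basic_nontrivial[of "A c"] h_onto[of c Bot] h_onto[of c Top] by auto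

lemma index_le_iff:
  assumes x: "x \<in> carrier M" "x \<noteq> \<one>" and y: "y \<in> carrier M" "y \<noteq> \<one>"
  shows "(index x, index y) \<in> r \<longleftrightarrow> J_le x y"
proof -
  have "J_le x y \<longleftrightarrow> h (x \<otimes> y \<otimes> x) = h x"
    using h_inj[of "x \<otimes> y \<otimes> x" x] x y by (simp add: J_le_def)
  also have "\<dots> \<longleftrightarrow> nested_mult r A (nested_mult r A (h x) (h y)) (h x) = h x"
    using x y by (simp add: h_mult)
  also have "\<dots> \<longleftrightarrow> (index x, index y) \<in> r"
    using nested_absorb_iff[OF chain basic, of "index x" "sign x" "index y" "sign y"]
      h_Some[OF x] h_Some[OF y] x y by (simp add: sign_Unit del: nested_mult.simps)
  finally show ?thesis by simp
qed

lemma index_eq_iff: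
  assumes x: "x \<in> carrier M" "x \<noteq> \<one>" and y: "y \<in> carrier M" "y \<noteq> \<one>"
  shows "index x = index y \<longleftrightarrow> J_equiv x y"
proof -
  have "index x = index y \<longleftrightarrow> (index x, index y) \<in> r \<and> (index y, index x) \<in> r"
    using chain h_Some(2)[OF x] h_Some(2)[OF y]
    by (auto simp: order_on_defs refl_on_def dest: antisymD)
  then show ?thesis
    using index_le_iff[OF x y] index_le_iff[OF y x] by (simp add: J_equiv_def)
qed

lemma summand_eq_class_algebra:
  assumes a: "a \<in> carrier M" "a \<noteq> \<one>"
  shows "A (index a) = class_algebra a"
proof (rule class_algebra_eqI[OF a])
  show B: "A (index a) \<in> basic_algebras" using basic h_Some(2)[OF a] by blast
  have ne: "x \<noteq> \<one>" if "x \<in> carrier M" "J_equiv x a" for x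
    using that a J_equiv_one J_equiv_sym by blast
  show "s \<in> carrier (A (index a)) \<longleftrightarrow> (\<exists>x\<in>carrier M. J_equiv x a \<and> sign x = s)"
    if "s \<noteq> Unit" for s
  proof
    assume "s \<in> carrier (A (index a))"
    then show "\<exists>x\<in>carrier M. J_equiv x a \<and> sign x = s"
      using h_onto[OF h_Some(2)[OF a] _ that] index_eq_iff[OF _ _ a] by blast
  next
    assume "\<exists>x\<in>carrier M. J_equiv x a \<and> sign x = s"
    then obtain x where x: "x \<in> carrier M" "J_equiv x a" "sign x = s" by blast
    then show "s \<in> carrier (A (index a))"
      using h_Some(3)[OF x(1) ne] index_eq_iff[OF x(1) ne a] by simp
  qed
  show "sign (x \<otimes> y) = sign x \<otimes>\<^bsub>A (index a)\<^esub> sign y"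
    if x: "x \<in> carrier M" and y: "y \<in> carrier M" and eq: "J_equiv x a" "J_equiv y a" for x y
  proof -
    have nes: "x \<noteq> \<one>" "y \<noteq> \<one>" using ne x y eq by auto
    then have xy: "x \<otimes> y \<in> carrier M" "x \<otimes> y \<noteq> \<one>" using x y mult_conservative[OF x y] by auto
    have "index x = index a" "index y = index a"
      using index_eq_iff a x y nes eq by auto
    then have "h (x \<otimes> y) = Some (index a, sign x \<otimes>\<^bsub>A (index a)\<^esub> sign y)"
      using h_mult[OF x y] h_Some(1)[OF x nes(1)] h_Some(1)[OF y nes(2)]
        nested_mult_same[where A = A, OF B] nes by (simp add: sign_Unit del: nested_mult.simps)
    then show ?thesis using h_Some(1)[OF xy] by simp
  qed
qed

end

text \<open>Both index maps have the same fibres and reflect the same preorder, so sending the index of an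
  element in one sum to its index in the other is a chain isomorphism. The summands are even equal,
  being the algebra of the same class.\<close>

lemma nested_decompositions_agree:
  assumes "nested_decomposition M C r A h" and "nested_decomposition M D s B k"
  shows "\<exists>f\<in>chain_iso C r D s. \<forall>c\<in>C. B (f c) = A c"
proof -
  interpret L: nested_decomposition M C r A h by (rule assms(1))
  interpret R: nested_decomposition M D s B k by (rule assms(2))
  have "\<forall>c\<in>C. \<exists>x. x \<in> carrier M \<and> x \<noteq> \<one>\<^bsub>M\<^esub> \<and> L.index x = c"
    using L.index_onto by blast
  then obtain w where w: "\<And>c. c \<in> C \<Longrightarrow> w c \<in> carrier M \<and> w c \<noteq> \<one>\<^bsub>M\<^esub> \<and> L.index (w c) = c"
    by metis
  define f where "f c = R.index (w c)" for c
  have le: "(c, d) \<in> r \<longleftrightarrow> (f c, f d) \<in> s" if "c \<in> C" "d \<in> C" for c d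
    using L.index_le_iff[of "w c" "w d"] R.index_le_iff[of "w c" "w d"] w that by (simp add: f_def)
  have "inj_on f C"
  proof (rule inj_onI)
    fix c d assume cd: "c \<in> C" "d \<in> C" "f c = f d"
    then show "c = d"
      using L.index_eq_iff[of "w c" "w d"] R.index_eq_iff[of "w c" "w d"] w by (simp add: f_def)
  qed
  moreover have "f ` C = D"
  proof
    show "f ` C \<subseteq> D" using R.h_Some(2) w by (auto simp: f_def)
    show "D \<subseteq> f ` C"
    proof
      fix d assume "d \<in> D"
      then obtain y where y: "y \<in> carrier M" "y \<noteq> \<one>\<^bsub>M\<^esub>" "R.index y = d"
        using R.index_onto by blast
      have c: "L.index y \<in> C" using L.h_Some(2)[OF y(1,2)] .
      have "f (L.index y) = d"
        using L.index_eq_iff[of "w (L.index y)" y] R.index_eq_iff[of "w (L.index y)" y] w[OF c] y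
        by (simp add: f_def)
      then show "d \<in> f ` C" using c by blast
    qed
  qed
  ultimately have "f \<in> chain_iso C r D s"
    using le by (simp add: chain_iso_def bij_betw_def)
  moreover have "B (f c) = A c" if "c \<in> C" for c
    using L.summand_eq_class_algebra[of "w c"] R.summand_eq_class_algebra[of "w c"] w[OF that]
    by (simp add: f_def)
  ultimately show ?thesis by blast
qed


theorem theorem3p15:
  fixes M :: "'a ord_monoid"
  assumes "idem_ordered_monoid M"
  shows "(\<exists>(C :: 'a set) r (A :: 'a \<Rightarrow> elt ord_monoid).
            linear_order_on C r \<and> (\<forall>c\<in>C. A c \<in> {C2, C2_dual, G3, D3}) \<and>
            M \<cong>\<^sub>o\<^sub>m nested_sum C r A) \<and>
         (\<forall>(C :: 'c set) r (A :: 'c \<Rightarrow> elt ord_monoid) (D :: 'd set) s (B :: 'd \<Rightarrow> elt ord_monoid).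
            linear_order_on C r \<and> (\<forall>c\<in>C. A c \<in> {C2, C2_dual, G3, D3}) \<and>
            M \<cong>\<^sub>o\<^sub>m nested_sum C r A \<and>
            linear_order_on D s \<and> (\<forall>d\<in>D. B d \<in> {C2, C2_dual, G3, D3}) \<and>
            M \<cong>\<^sub>o\<^sub>m nested_sum D s B \<longrightarrow>
            (\<exists>f \<in> chain_iso C r D s. \<forall>c\<in>C. A c \<cong>\<^sub>o\<^sub>m B (f c)))"
proof (intro conjI allI impI)
  interpret idem_ordered_monoid M by (rule assms)
  show "\<exists>(C :: 'a set) r (A :: 'a \<Rightarrow> elt ord_monoid).
      linear_order_on C r \<and> (\<forall>c\<in>C. A c \<in> {C2, C2_dual, G3, D3}) \<and> M \<cong>\<^sub>o\<^sub>m nested_sum C r A"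
    using linear_order_rep class_algebra_basic nested_sum_decomposition by blast
next
  fix C :: "'c set" and r and A :: "'c \<Rightarrow> elt ord_monoid"
    and D :: "'d set" and s and B :: "'d \<Rightarrow> elt ord_monoid"
  assume dec: "linear_order_on C r \<and> (\<forall>c\<in>C. A c \<in> {C2, C2_dual, G3, D3}) \<and>
      M \<cong>\<^sub>o\<^sub>m nested_sum C r A \<and>
      linear_order_on D s \<and> (\<forall>d\<in>D. B d \<in> {C2, C2_dual, G3, D3}) \<and>
      M \<cong>\<^sub>o\<^sub>m nested_sum D s B"
  then obtain h k where "h \<in> om_iso M (nested_sum C r A)" "k \<in> om_iso M (nested_sum D s B)"
    unfolding is_om_iso_def by blast
  with dec assms have "nested_decomposition M C r A h" "nested_decomposition M D s B k"
    by (auto simp: nested_decomposition_def nested_decomposition_axioms_def)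
  then obtain f where "f \<in> chain_iso C r D s" "\<forall>c\<in>C. B (f c) = A c"
    using nested_decompositions_agree by blast
  then show "\<exists>f\<in>chain_iso C r D s. \<forall>c\<in>C. A c \<cong>\<^sub>o\<^sub>m B (f c)"
    using om_iso_refl by (metis)
qed

end
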